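(* (Alexander duality for quasi-graded posets.) Let $(P,\rho,\bar\zeta)$ be an Eulerian quasi-graded poset with $\hat0$ and $\hat1$ of rank $n+1$. Let $Q$ and $R$ be two subposets of $P$ such that $Q\cup R=P$ and $Q\cap R=\{\hat0,\hat1\}$. Then $$(\bar\zeta|_Q)^{-1}(\hat0,\hat1)=(-1)^n\cdot(\bar\zeta|_R)^{-1}(\hat0,\hat1).$$
   Context: A quasi-graded poset $(P,\rho,\bar\zeta)$ consists of a finite poset $P$, a function $\rho:P\to\mathbb N$ with $x<y\Rightarrow\rho(x)<\rho(y)$, and a complex-valued function $\bar\zeta$ in the incidence algebra of $P$ with $\bar\zeta(x,x)=1$ for all $x$. Write $\rho(x,y)=\rho(y)-\rho(x)$. It is Eulerian if for all $x\le z$ $$\sum_{x\le y\le z}(-1)^{\rho(x,y)}\,\bar\zeta(x,y)\,\bar\zeta(y,z)=\delta_{x,z}.$$ Here $\hat0$ and $\hat1$ are the minimal and maximal elements of $P$, and rank $n+1$ means $\rho(\hat0,\hat1)=n+1$, $n\ge0$. Subposets carry the induced order. $\bar\zeta|_Q$ is the restriction of $\bar\zeta$ to pairs $x\le y$ in $Q$, and $(\bar\zeta|_Q)^{-1}$ is its inverse in the incidence algebra of $Q$ (product $(f\cdot g)(x,y)=\sum_{x\le z\le y,\,z\in Q}f(x,z)g(z,y)$, identity $\delta_{x,y}$); similarly for $R$. *)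

theory Defs
  imports "HOL-Algebra.Ring" Complex_Main
begin

text \<open>
  A finite poset is a finite carrier set \<open>P\<close> with an order relation \<open>r\<close> on it;
  \<open>(x, y) \<in> r\<close> means \<open>x \<le> y\<close>.  A subposet is a subset \<open>Q\<close> of \<open>P\<close> with the induced
  order \<open>Restr r Q\<close>.

  Elements of the incidence algebra are functions on the pairs \<open>x \<le> y\<close> of the poset, represented
  as total functions extended by zero, so that equality of functions is equality in the algebra.
\<close>

definition incidence_algebra :: "'a set \<Rightarrow> 'a rel \<Rightarrow> ('a \<Rightarrow> 'a \<Rightarrow> complex) ring"
  where "incidence_algebra A r =
    \<lparr> carrier = {f. \<forall>x y. (x, y) \<notin> r \<longrightarrow> f x y = 0},
      mult = (\<lambda>f g x y. \<Sum>z | z \<in> A \<and> (x, z) \<in> r \<and> (z, y) \<in> r. f x z * g z y),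
      one = (\<lambda>x y. if x \<in> A \<and> x = y then 1 else 0),
      zero = (\<lambda>x y. 0),
      add = (\<lambda>f g x y. f x y + g x y) \<rparr>"

definition restrict_incidence ::
  "('a \<Rightarrow> 'a \<Rightarrow> complex) \<Rightarrow> 'a rel \<Rightarrow> 'a set \<Rightarrow> 'a \<Rightarrow> 'a \<Rightarrow> complex"
  where "restrict_incidence f r Q = (\<lambda>x y. if (x, y) \<in> Restr r Q then f x y else 0)"

definition subposet_inverse ::
  "('a \<Rightarrow> 'a \<Rightarrow> complex) \<Rightarrow> 'a rel \<Rightarrow> 'a set \<Rightarrow> 'a \<Rightarrow> 'a \<Rightarrow> complex"
  where "subposet_inverse f r Q =
    inv\<^bsub>incidence_algebra Q (Restr r Q)\<^esub> (restrict_incidence f r Q)"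

text \<open>
  The subtraction is that of \<^typ>\<open>nat\<close>; it does not truncate when \<open>x \<le> y\<close> in a
  quasi-graded poset, which is the only case in which it is used.
\<close>

definition rank_diff :: "('a \<Rightarrow> nat) \<Rightarrow> 'a \<Rightarrow> 'a \<Rightarrow> nat"
  where "rank_diff \<rho> x y = \<rho> y - \<rho> x"

locale quasi_graded_poset =
  fixes P :: "'a set" and r :: "'a rel" and \<rho> :: "'a \<Rightarrow> nat"
    and \<zeta> :: "'a \<Rightarrow> 'a \<Rightarrow> complex"
  assumes finite_carrier: "finite P"
    and partial_order: "partial_order_on P r"
    and rank_strict: "\<And>x y. (x, y) \<in> r \<Longrightarrow> x \<noteq> y \<Longrightarrow> \<rho> x < \<rho> y"
    and zeta_incidence: "\<zeta> \<in> carrier (incidence_algebra P r)"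
    and zeta_diag: "\<And>x. x \<in> P \<Longrightarrow> \<zeta> x x = 1"

locale eulerian_quasi_graded_poset = quasi_graded_poset +
  assumes eulerian: "\<And>x z. (x, z) \<in> r \<Longrightarrow>
    (\<Sum>y | y \<in> P \<and> (x, y) \<in> r \<and> (y, z) \<in> r. (-1) ^ rank_diff \<rho> x y * \<zeta> x y * \<zeta> y z)
      = (if x = z then 1 else 0)"

definition is_bottom :: "'a set \<Rightarrow> 'a rel \<Rightarrow> 'a \<Rightarrow> bool"
  where "is_bottom P r b \<longleftrightarrow> b \<in> P \<and> (\<forall>x\<in>P. (b, x) \<in> r)"

definition is_top :: "'a set \<Rightarrow> 'a rel \<Rightarrow> 'a \<Rightarrow> bool"
  where "is_top P r t \<longleftrightarrow> t \<in> P \<and> (\<forall>x\<in>P. (x, t) \<in> r)"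

end

theory Submission
  imports Defs
begin

text \<open>
  Write \<open>\<mu>(x, y) = (-1)\<^bsup>\<rho>(x, y)\<^esup> \<zeta>(x, y)\<close>; the Eulerian condition says \<open>\<mu> \<zeta> = 1\<close>.
  Let \<open>u\<close> be the column at \<open>t\<close> of the inverse of \<open>\<zeta>\<close> on \<open>Q\<close>, and \<open>v\<close> the row at \<open>b\<close> of
  the inverse of \<open>\<zeta>\<close> on \<open>R\<close>, multiplied by the signs \<open>(-1)\<^bsup>\<rho>\<^esup>\<close>, both extended by zero to
  \<open>P\<close>.  As \<open>Q \<inter> R = {b, t}\<close>, the pairing \<open>v u\<close> has only the terms at \<open>b\<close> and \<open>t\<close>, and
  these are the two sides of the claim up to sign.  On the other hand \<open>v u = (v \<mu>) (\<zeta> u)\<close>, where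
  \<open>v \<mu>\<close> vanishes on \<open>R\<close> except at \<open>b\<close> and \<open>\<zeta> u\<close> vanishes on \<open>Q\<close> except at \<open>t\<close>; as
  \<open>Q \<union> R = P\<close> and \<open>b \<noteq> t\<close>, the pairing is zero.
\<close>

section \<open>The incidence algebra of a finite poset\<close>

locale finite_poset =
  fixes A :: "'a set" and r :: "'a rel"
  assumes finite: "finite A" and partial_order: "partial_order_on A r"
begin

lemma refl: "x \<in> A \<Longrightarrow> (x, x) \<in> r"
  and antisym: "(x, y) \<in> r \<Longrightarrow> (y, x) \<in> r \<Longrightarrow> x = y"
  and trans: "(x, y) \<in> r \<Longrightarrow> (y, z) \<in> r \<Longrightarrow> (x, z) \<in> r"
  and in_carrier: "(x, y) \<in> r \<Longrightarrow> x \<in> A \<and> y \<in> A"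
  using partial_order
  by (auto simp: partial_order_on_def preorder_on_def refl_on_def antisym_def
      elim: transE)

lemma finite_poset_Restr:
  assumes "B \<subseteq> A"
  shows "finite_poset B (Restr r B)"
proof
  show "finite B"
    using assms finite finite_subset by blast
  show "partial_order_on B (Restr r B)"
    using assms refl antisym trans
    unfolding partial_order_on_def preorder_on_def refl_on_def antisym_def trans_def by blast
qed

text \<open>Finiteness turns acyclicity of the strict order into well-foundedness of its converse;
  this permits recursion from the top of the poset downwards.\<close>

lemma wf_greater: "wf {(z, x). (x, z) \<in> r \<and> x \<noteq> z}"
proof -
  have "finite r"
    by (rule finite_subset[of _ "A \<times> A"]) (use in_carrier finite in auto)
  moreover have "acyclic (r - Id)"
  proof -
    have "trans (r - Id)"
      unfolding trans_def using trans antisym by blast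
    then show ?thesis
      by (simp add: acyclic_def)
  qed
  ultimately have "wf ((r - Id)\<inverse>)"
    by (intro finite_acyclic_wf_converse) auto
  moreover have "(r - Id)\<inverse> = {(z, x). (x, z) \<in> r \<and> x \<noteq> z}"
    by auto
  ultimately show ?thesis
    by simp
qed

abbreviation I where "I \<equiv> incidence_algebra A r"

lemma carrier_iff: "f \<in> carrier I \<longleftrightarrow> (\<forall>x y. (x, y) \<notin> r \<longrightarrow> f x y = 0)"
  by (simp add: incidence_algebra_def)

lemma one_apply: "\<one>\<^bsub>I\<^esub> x y = (if x \<in> A \<and> x = y then 1 else 0)"
  by (simp add: incidence_algebra_def)

text \<open>Elements of the algebra vanish off \<open>r\<close>, so the terms outside the interval
  contribute nothing. With the sum over all of \<open>A\<close>, products behave like matrix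
  products.\<close>

lemma mult_apply:
  assumes "f \<in> carrier I" "g \<in> carrier I"
  shows "(f \<otimes>\<^bsub>I\<^esub> g) x y = (\<Sum>z\<in>A. f x z * g z y)"
proof -
  have "(\<Sum>z | z \<in> A \<and> (x, z) \<in> r \<and> (z, y) \<in> r. f x z * g z y) = (\<Sum>z\<in>A. f x z * g z y)"
    using assms finite by (intro sum.mono_neutral_left) (auto simp: carrier_iff)
  then show ?thesis
    by (simp add: incidence_algebra_def)
qed

lemma mult_closed:
  assumes "f \<in> carrier I" "g \<in> carrier I"
  shows "f \<otimes>\<^bsub>I\<^esub> g \<in> carrier I"
  unfolding carrier_iff
proof (intro allI impI)
  fix x y assume "(x, y) \<notin> r"
  then have "(x, z) \<notin> r \<or> (z, y) \<notin> r" for z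
    using trans by blast
  then show "(f \<otimes>\<^bsub>I\<^esub> g) x y = 0"
    unfolding mult_apply[OF assms] using assms
    by (intro sum.neutral ballI) (metis carrier_iff mult_eq_0_iff)
qed

text \<open>Gives access to the theory of \<open>Units\<close> and \<open>inv\<close>; associativity
  is an exchange of summations.\<close>

lemma monoid_incidence_algebra: "monoid I"
proof
  show "\<one>\<^bsub>I\<^esub> \<in> carrier I"
    by (auto simp: carrier_iff one_apply refl)
  fix f assume f: "f \<in> carrier I"
  show "\<one>\<^bsub>I\<^esub> \<otimes>\<^bsub>I\<^esub> f = f"
  proof (intro ext)
    fix x y
    have "(\<one>\<^bsub>I\<^esub> \<otimes>\<^bsub>I\<^esub> f) x y = (\<Sum>z\<in>A. if z = x then f x y else 0)"
      by (auto simp: mult_apply[OF \<open>\<one>\<^bsub>I\<^esub> \<in> carrier I\<close> f] one_apply intro!: sum.cong)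
    also have "\<dots> = f x y"
      using f in_carrier finite by (auto simp: carrier_iff)
    finally show "(\<one>\<^bsub>I\<^esub> \<otimes>\<^bsub>I\<^esub> f) x y = f x y" .
  qed
  show "f \<otimes>\<^bsub>I\<^esub> \<one>\<^bsub>I\<^esub> = f"
  proof (intro ext)
    fix x y
    have "(f \<otimes>\<^bsub>I\<^esub> \<one>\<^bsub>I\<^esub>) x y = (\<Sum>z\<in>A. if z = y then f x y else 0)"
      by (auto simp: mult_apply[OF f \<open>\<one>\<^bsub>I\<^esub> \<in> carrier I\<close>] one_apply intro!: sum.cong)
    also have "\<dots> = f x y"
      using f in_carrier finite by (auto simp: carrier_iff)
    finally show "(f \<otimes>\<^bsub>I\<^esub> \<one>\<^bsub>I\<^esub>) x y = f x y" .
  qed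
  fix g h assume g: "g \<in> carrier I" and h: "h \<in> carrier I"
  show "f \<otimes>\<^bsub>I\<^esub> g \<otimes>\<^bsub>I\<^esub> h = f \<otimes>\<^bsub>I\<^esub> (g \<otimes>\<^bsub>I\<^esub> h)"
  proof (intro ext)
    fix x y
    have "(\<Sum>z\<in>A. (\<Sum>w\<in>A. f x w * g w z) * h z y) = (\<Sum>w\<in>A. f x w * (\<Sum>z\<in>A. g w z * h z y))"
      unfolding sum_distrib_left sum_distrib_right mult.assoc by (rule sum.swap)
    then show "(f \<otimes>\<^bsub>I\<^esub> g \<otimes>\<^bsub>I\<^esub> h) x y = (f \<otimes>\<^bsub>I\<^esub> (g \<otimes>\<^bsub>I\<^esub> h)) x y"
      by (simp add: mult_apply mult_closed f g h)
  qed
qed (rule mult_closed)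

lemma mult_diag:
  assumes "f \<in> carrier I" "g \<in> carrier I" "x \<in> A"
  shows "(f \<otimes>\<^bsub>I\<^esub> g) x x = f x x * g x x"
proof -
  have "f x z * g z x = 0" if "z \<noteq> x" for z
  proof -
    have "(x, z) \<notin> r \<or> (z, x) \<notin> r"
      using that antisym by blast
    then show ?thesis
      using assms by (auto simp: carrier_iff)
  qed
  then have "(\<Sum>z\<in>A. f x z * g z x) = (\<Sum>z\<in>A. if z = x then f x x * g x x else 0)"
    by (intro sum.cong) auto
  then show ?thesis
    using assms finite by (simp add: mult_apply)
qed

section \<open>Invertibility of functions with unit diagonal\<close>

text \<open>Since \<open>f x x = 1\<close>, the equation at \<open>(x, y)\<close> can be solved for
  \<open>h x y\<close> in terms of the values \<open>h z y\<close> with \<open>z\<close> strictly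
  above \<open>x\<close>.\<close>

lemma right_inverse_exists:
  assumes f: "f \<in> carrier I" and diag: "\<And>x. x \<in> A \<Longrightarrow> f x x = 1"
  obtains h where "h \<in> carrier I" "f \<otimes>\<^bsub>I\<^esub> h = \<one>\<^bsub>I\<^esub>"
proof -
  \<comment> \<open>\<open>F y\<close> is one step of the recursion for column \<open>y\<close>; the
    value 0 off \<open>r\<close> puts \<open>h\<close> into the carrier.\<close>
  define F where "F y h x = (if (x, y) \<in> r then
      (if x = y then 1 else 0) - (\<Sum>z | z \<in> A \<and> (x, z) \<in> r \<and> x \<noteq> z. f x z * h z) else 0)"
    for y and h :: "'a \<Rightarrow> complex" and x
  define h where "h x y = wfrec {(z, x). (x, z) \<in> r \<and> x \<noteq> z} (F y) x" for x y
  have rec: "h x y = F y (\<lambda>z. h z y) x" for x y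
  proof -
    have "h x y = F y (cut (\<lambda>z. h z y) {(z, x). (x, z) \<in> r \<and> x \<noteq> z} x) x"
      unfolding h_def by (rule wfrec[OF wf_greater])
    \<comment> \<open>\<open>F\<close> reads only values strictly above \<open>x\<close>, where the
      cut changes nothing.\<close>
    also have "\<dots> = F y (\<lambda>z. h z y) x"
      by (auto simp: F_def cut_apply intro!: sum.cong)
    finally show ?thesis .
  qed
  have h: "h \<in> carrier I"
    unfolding carrier_iff by (subst rec) (simp add: F_def)
  have "f \<otimes>\<^bsub>I\<^esub> h = \<one>\<^bsub>I\<^esub>"
  proof (intro ext)
    fix x y
    show "(f \<otimes>\<^bsub>I\<^esub> h) x y = \<one>\<^bsub>I\<^esub> x y"
    proof (cases "(x, y) \<in> r")
      case True
      then have x: "x \<in> A"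
        using in_carrier by blast
      have "(f \<otimes>\<^bsub>I\<^esub> h) x y = f x x * h x y + (\<Sum>z\<in>A - {x}. f x z * h z y)"
        by (simp add: mult_apply f h sum.remove[OF finite x])
      also have "(\<Sum>z\<in>A - {x}. f x z * h z y)
          = (\<Sum>z | z \<in> A \<and> (x, z) \<in> r \<and> x \<noteq> z. f x z * h z y)"
        using f finite by (intro sum.mono_neutral_right) (auto simp: carrier_iff)
      finally show ?thesis
        using True x by (subst (asm) rec) (simp add: F_def diag one_apply)
    next
      case False
      then have "(f \<otimes>\<^bsub>I\<^esub> h) x y = 0"
        using mult_closed[OF f h] by (simp add: carrier_iff)
      with False show ?thesis
        by (auto simp: one_apply refl)
    qed
  qed
  with h show thesis ..
qed

text \<open>The right inverse \<open>h\<close> of \<open>f\<close> again has unit diagonal, hence a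
  right inverse \<open>k\<close>. Then \<open>f = f (h k) = (f h) k = k\<close>, so \<open>h\<close>
  is two-sided.\<close>

lemma unit_of_unit_diagonal:
  assumes f: "f \<in> carrier I" and diag: "\<And>x. x \<in> A \<Longrightarrow> f x x = 1"
  shows "f \<in> Units I"
proof -
  interpret monoid I
    by (rule monoid_incidence_algebra)
  obtain h where h: "h \<in> carrier I" "f \<otimes>\<^bsub>I\<^esub> h = \<one>\<^bsub>I\<^esub>"
    using right_inverse_exists[OF f diag] .
  have "h x x = 1" if "x \<in> A" for x
    using mult_diag[OF f h(1) that] h(2) that by (simp add: diag one_apply)
  then obtain k where k: "k \<in> carrier I" "h \<otimes>\<^bsub>I\<^esub> k = \<one>\<^bsub>I\<^esub>"
    using right_inverse_exists[OF h(1)] by blast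
  have "f = k"
    using m_assoc[OF f h(1) k(1)] f h k by simp
  then show ?thesis
    using f h k by (auto simp: Units_def)
qed

section \<open>Inverses on subposets\<close>

text \<open>Because \<open>g\<close> is zero off \<open>B\<close>, the inverse equations on
  \<open>B\<close> can be written with the unrestricted \<open>f\<close> and sums over
  \<open>A\<close>, as long as the free index of \<open>f\<close> stays in \<open>B\<close>.\<close>

lemma subposet_inverse:
  assumes f: "f \<in> carrier I" and diag: "\<forall>x\<in>A. f x x = 1" and B: "B \<subseteq> A"
  defines "g \<equiv> subposet_inverse f r B"
  shows subposet_inverse_outside: "x \<notin> B \<or> y \<notin> B \<Longrightarrow> g x y = 0"
    and subposet_inverse_diag: "x \<in> B \<Longrightarrow> g x x = 1"
    and subposet_inverse_right:
      "x \<in> B \<Longrightarrow> (\<Sum>z\<in>A. f x z * g z y) = (if x = y then 1 else 0)"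
    and subposet_inverse_left:
      "y \<in> B \<Longrightarrow> (\<Sum>z\<in>A. g x z * f z y) = (if x = y then 1 else 0)"
proof -
  interpret B: finite_poset B "Restr r B"
    by (rule finite_poset_Restr[OF B])
  interpret monoid B.I
    by (rule B.monoid_incidence_algebra)
  let ?f = "restrict_incidence f r B"
  have fB: "?f \<in> carrier B.I"
    by (simp add: B.carrier_iff restrict_incidence_def)
  have f_diag: "?f x x = 1" if "x \<in> B" for x
    using that B by (auto simp: restrict_incidence_def diag refl)
  \<comment> \<open>\<open>inv\<close> is a definite description, so its equations follow only once
    \<open>?f\<close> is known to be a unit.\<close>
  have unit: "?f \<in> Units B.I"
    using B.unit_of_unit_diagonal[OF fB f_diag] .
  have g: "g \<in> carrier B.I" "?f \<otimes>\<^bsub>B.I\<^esub> g = \<one>\<^bsub>B.I\<^esub>" "g \<otimes>\<^bsub>B.I\<^esub> ?f = \<one>\<^bsub>B.I\<^esub>"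
    unfolding g_def subposet_inverse_def using unit by simp_all
  show outside: "g x y = 0" if "x \<notin> B \<or> y \<notin> B" for x y
    using g(1) that by (auto simp: B.carrier_iff)
  show "g x x = 1" if "x \<in> B" for x
    using B.mult_diag[OF fB g(1) that] that by (simp add: g(2) f_diag B.one_apply)
  have f_eq: "?f x y = f x y" if "x \<in> B" "y \<in> B" for x y
    using f that by (auto simp: restrict_incidence_def carrier_iff)
  show "(\<Sum>z\<in>A. f x z * g z y) = (if x = y then 1 else 0)" if "x \<in> B" for x y
  proof -
    have "(\<Sum>z\<in>A. f x z * g z y) = (\<Sum>z\<in>B. ?f x z * g z y)"
      using B finite that by (intro sum.mono_neutral_cong_right) (auto simp: outside f_eq)
    also have "\<dots> = \<one>\<^bsub>B.I\<^esub> x y"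
      using B.mult_apply[OF fB g(1)] g(2) by simp
    finally show ?thesis
      using that by (simp add: B.one_apply)
  qed
  show "(\<Sum>z\<in>A. g x z * f z y) = (if x = y then 1 else 0)" if "y \<in> B" for x y
  proof -
    have "(\<Sum>z\<in>A. g x z * f z y) = (\<Sum>z\<in>B. g x z * ?f z y)"
      using B finite that by (intro sum.mono_neutral_cong_right) (auto simp: outside f_eq)
    also have "\<dots> = \<one>\<^bsub>B.I\<^esub> x y"
      using B.mult_apply[OF g(1) fB] g(3) by simp
    finally show ?thesis
      using that by (auto simp: B.one_apply)
  qed
qed

end

sublocale quasi_graded_poset \<subseteq> finite_poset P r
  using finite_carrier partial_order by unfold_locales

section \<open>The Eulerian identity and the duality\<close>

context eulerian_quasi_graded_poset
begin

text \<open>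
  Replacing the sign exponent \<open>\<rho>(x, y)\<close> by \<open>\<rho> x + \<rho> y\<close> avoids the truncated subtraction.
\<close>

lemma eulerian_sum:
  assumes "x \<in> P"
  shows "(\<Sum>y\<in>P. (-1) ^ (\<rho> x + \<rho> y) * \<zeta> x y * \<zeta> y z) = (if x = z then 1 else 0)"
proof (cases "(x, z) \<in> r")
  case True
  have "(\<Sum>y\<in>P. (-1) ^ (\<rho> x + \<rho> y) * \<zeta> x y * \<zeta> y z)
      = (\<Sum>y | y \<in> P \<and> (x, y) \<in> r \<and> (y, z) \<in> r. (-1) ^ rank_diff \<rho> x y * \<zeta> x y * \<zeta> y z)"
  proof (rule sum.mono_neutral_cong_right[OF finite_carrier])
    fix y assume "y \<in> {y \<in> P. (x, y) \<in> r \<and> (y, z) \<in> r}"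
    then have "\<rho> x \<le> \<rho> y"
      using rank_strict[of x y] by (cases "x = y") auto
    then have "\<rho> x + \<rho> y = rank_diff \<rho> x y + 2 * \<rho> x"
      by (simp add: rank_diff_def)
    then show "(-1) ^ (\<rho> x + \<rho> y) * \<zeta> x y * \<zeta> y z = (-1) ^ rank_diff \<rho> x y * \<zeta> x y * \<zeta> y z"
      by (simp add: power_add)
  qed (use zeta_incidence in \<open>auto simp: carrier_iff\<close>)
  then show ?thesis
    using eulerian[OF True] by simp
next
  case False
  \<comment> \<open>Off \<open>r\<close> every term vanishes by transitivity, which extends the
    Eulerian identity to a matrix identity over \<open>P\<close>.\<close>
  then have "(x, y) \<notin> r \<or> (y, z) \<notin> r" for y
    using trans by blast
  then have "\<zeta> x y = 0 \<or> \<zeta> y z = 0" for y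
    using zeta_incidence unfolding carrier_iff by blast
  then have "(-1) ^ (\<rho> x + \<rho> y) * \<zeta> x y * \<zeta> y z = 0" for y
    by (metis mult_zero_left mult_zero_right)
  with False assms show ?thesis
    using refl by (auto simp: sum.neutral)
qed

lemma alexander_duality:
  assumes "b \<noteq> t" "Q \<union> R = P" "Q \<inter> R = {b, t}"
  shows "(-1) ^ \<rho> b * subposet_inverse \<zeta> r Q b t + (-1) ^ \<rho> t * subposet_inverse \<zeta> r R b t = 0"
proof -
  have Q: "Q \<subseteq> P" and R: "R \<subseteq> P" and bt: "b \<in> Q" "b \<in> R" "t \<in> Q" "t \<in> R"
    using assms by auto
  have diag: "\<forall>x\<in>P. \<zeta> x x = 1"
    using zeta_diag by blast
  note Q_inv = subposet_inverse[OF zeta_incidence diag Q]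
  note R_inv = subposet_inverse[OF zeta_incidence diag R]
  define u where "u x = subposet_inverse \<zeta> r Q x t" for x
  define v where "v x = (-1) ^ \<rho> x * subposet_inverse \<zeta> r R b x" for x
  define \<mu> where "\<mu> x y = (-1) ^ (\<rho> x + \<rho> y) * \<zeta> x y" for x y
  define w where "w y = (\<Sum>x\<in>P. \<zeta> y x * u x)" for y
  \<comment> \<open>Inserts \<mu> \<zeta> = 1 in front of \<open>u\<close>.\<close>
  have u_eq: "u x = (\<Sum>y\<in>P. \<mu> x y * w y)" if x: "x \<in> P" for x
  proof -
    have "(\<Sum>y\<in>P. \<mu> x y * w y) = (\<Sum>z\<in>P. (\<Sum>y\<in>P. \<mu> x y * \<zeta> y z) * u z)"
      unfolding w_def sum_distrib_left sum_distrib_right mult.assoc by (rule sum.swap)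
    also have "\<dots> = (\<Sum>z\<in>P. if x = z then u x else 0)"
      by (intro sum.cong) (auto simp: \<mu>_def eulerian_sum[OF x])
    finally show ?thesis
      using x finite_carrier by simp
  qed
  have v_\<mu>: "(\<Sum>x\<in>P. v x * \<mu> x y) = 0" if "y \<in> R" "y \<noteq> b" for y
  proof -
    \<comment> \<open>The sign of \<open>x\<close> occurs in both factors and squares to 1; only the
      sign of \<open>y\<close> remains, and it leaves the sum.\<close>
    have "v x * \<mu> x y = (-1) ^ \<rho> y * (subposet_inverse \<zeta> r R b x * \<zeta> x y)" for x
      by (simp add: v_def \<mu>_def power_add flip: power_mult_distrib)
    then have "(\<Sum>x\<in>P. v x * \<mu> x y)
        = (-1) ^ \<rho> y * (\<Sum>x\<in>P. subposet_inverse \<zeta> r R b x * \<zeta> x y)"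
      by (simp add: sum_distrib_left)
    then show ?thesis
      using R_inv(4)[OF that(1)] that(2) by simp
  qed
  have w_Q: "w y = 0" if "y \<in> Q" "y \<noteq> t" for y
    using Q_inv(3)[OF that(1)] that(2) by (simp add: w_def u_def)
  have "(\<Sum>x\<in>P. v x * u x) = (\<Sum>x\<in>P. v x * (\<Sum>y\<in>P. \<mu> x y * w y))"
    by (intro sum.cong) (auto simp: u_eq)
  also have "\<dots> = (\<Sum>y\<in>P. (\<Sum>x\<in>P. v x * \<mu> x y) * w y)"
    unfolding sum_distrib_left sum_distrib_right mult.assoc by (rule sum.swap)
  also have "\<dots> = 0"
  proof (intro sum.neutral ballI)
    fix y assume "y \<in> P"
    \<comment> \<open>The only point of \<open>R\<close> missed by the first case is
      \<open>b\<close>, which lies in \<open>Q\<close> and differs from \<open>t\<close>. A point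
      outside \<open>R\<close> lies in \<open>Q\<close> and is not \<open>t\<close>, as
      \<open>t\<close> is in \<open>R\<close>.\<close>
    then consider "y \<in> R" "y \<noteq> b" | "y \<in> Q" "y \<noteq> t"
      using assms by blast
    then show "(\<Sum>x\<in>P. v x * \<mu> x y) * w y = 0"
      by cases (simp_all add: v_\<mu> w_Q)
  qed
  finally have "(\<Sum>x\<in>P. v x * u x) = 0" .
  moreover have "(\<Sum>x\<in>P. v x * u x) = (\<Sum>x\<in>{b, t}. v x * u x)"
  proof (rule sum.mono_neutral_right[OF finite_carrier])
    show "{b, t} \<subseteq> P"
      using bt Q by auto
    show "\<forall>x\<in>P - {b, t}. v x * u x = 0"
    proof
      fix x assume "x \<in> P - {b, t}"
      then have "x \<notin> Q \<or> x \<notin> R"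
        using assms(3) by blast
      then show "v x * u x = 0"
        by (auto simp: u_def v_def Q_inv(1) R_inv(1))
    qed
  qed
  \<comment> \<open>The unit diagonals give \<open>u t = 1\<close> and
    \<open>v b = (-1) ^ \<rho> b\<close>, so each of the two remaining terms contains a single
    inverse.\<close>
  ultimately show ?thesis
    using \<open>b \<noteq> t\<close> bt by (simp add: u_def v_def Q_inv(2) R_inv(2))
qed

end

theorem theorem3p7:
  fixes P Q R :: "'a set" and r :: "'a rel" and \<rho> :: "'a \<Rightarrow> nat"
    and \<zeta> :: "'a \<Rightarrow> 'a \<Rightarrow> complex" and b t :: 'a and n :: nat
  assumes "eulerian_quasi_graded_poset P r \<rho> \<zeta>"
    and "is_bottom P r b" and "is_top P r t"
    and "rank_diff \<rho> b t = n + 1"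
    and "Q \<subseteq> P" and "R \<subseteq> P"
    and "Q \<union> R = P" and "Q \<inter> R = {b, t}"
  shows "subposet_inverse \<zeta> r Q b t = (-1) ^ n * subposet_inverse \<zeta> r R b t"
proof -
  interpret eulerian_quasi_graded_poset P r \<rho> \<zeta>
    by (rule assms(1))
  \<comment> \<open>The difference \<open>n + 1\<close> is positive, so the subtraction is not
    truncated and the two elements are distinct.\<close>
  have \<rho>t: "\<rho> t = \<rho> b + (n + 1)" and "b \<noteq> t"
    using assms(4) by (auto simp: rank_diff_def)
  \<comment> \<open>The sign of \<open>n + 1\<close> is opposite to that of \<open>n\<close>, which
    turns the sum into a difference.\<close>
  have "(-1) ^ \<rho> b
      * (subposet_inverse \<zeta> r Q b t - (-1) ^ n * subposet_inverse \<zeta> r R b t) = 0"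
    using alexander_duality[OF \<open>b \<noteq> t\<close> assms(7,8)]
    by (simp add: \<rho>t power_add algebra_simps)
  then show ?thesis
    by simp
qed

end
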